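(* For every positive integer $c$ and every $\delta>0$ there exists an instance of the linearly correlated prophet problem with $n=s_{\mathrm{row}}=s_{\mathrm{col}}=c$ such that every online algorithm for the fractional variant (and hence every online algorithm for the standard problem) satisfies $\mathbb{E}[\max_i X_i]\ge (c-\delta)\,\mathbb{E}[\mathrm{ALG}]$. In particular, no online algorithm, even fractional, can guarantee an approximation ratio smaller than $\min\{s_{\mathrm{col}},s_{\mathrm{row}}\}$.
   Context: Linearly correlated prophet problem: there are $m$ mutually independent nonnegative random variables $Y_1,\dots,Y_m$ and a matrix $A\in\mathbb{R}_{\ge 0}^{n\times m}$; the values are $X_i=\sum_j A_{ij}Y_j$. Row (column) sparsity $s_{\mathrm{row}}$ ($s_{\mathrm{col}}$) is the maximum number of nonzero entries in a row (column) of $A$. An online algorithm knows $A$ and the distributions of the $Y_j$, observes $X_1,\dots,X_n$ one at a time (never the $Y_j$), and after observing $X_i$ either stops with reward $X_i$ or irrevocably rejects it. In the fractional variant, upon observing $X_i$ the algorithm chooses a fraction $p_i\ge0$ (depending only on what it has observed so far and its own randomness), subject to $\sum_{i=1}^n p_i\le 1$ with probability $1$, and its reward is $\sum_i p_iX_i$. An approximation ratio $\alpha$ means $\mathbb{E}[\mathrm{ALG}]\ge\frac1\alpha\mathbb{E}[\max_iX_i]$ on every instance. *)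

theory Defs
  imports "HOL-Probability.Probability"
begin

text \<open>
  Indices are 0-based: the values are \<open>X 0, \<dots>, X (n - 1)\<close> and the hidden sources
  \<open>Y 0, \<dots>, Y (m - 1)\<close>, with \<open>n = num_values I\<close> and \<open>m = num_sources I\<close>. Entries of the
  matrix and sources with indices out of range are irrelevant.
\<close>

record 'a prophet_instance =
  num_values :: nat
  num_sources :: nat
  coeff :: "nat \<Rightarrow> nat \<Rightarrow> real"
  sample :: "'a measure"
  source :: "nat \<Rightarrow> 'a \<Rightarrow> real"

text \<open>
  Integrability of the sources makes all expectations below finite, so that Bochner integrals
  do not silently take their default value 0.
\<close>

definition linear_prophet :: "'a prophet_instance \<Rightarrow> bool" where
  "linear_prophet I \<longleftrightarrow>
     num_values I > 0 \<and> num_sources I > 0 \<and>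
     (\<forall>i<num_values I. \<forall>j<num_sources I. coeff I i j \<ge> 0) \<and>
     prob_space (sample I) \<and>
     prob_space.indep_vars (sample I) (\<lambda>_. borel) (source I) {..<num_sources I} \<and>
     (\<forall>j<num_sources I. \<forall>\<omega>\<in>space (sample I). source I j \<omega> \<ge> 0) \<and>
     (\<forall>j<num_sources I. integrable (sample I) (source I j))"

definition X :: "'a prophet_instance \<Rightarrow> nat \<Rightarrow> 'a \<Rightarrow> real" where
  "X I i \<omega> = (\<Sum>j<num_sources I. coeff I i j * source I j \<omega>)"

definition s_row :: "'a prophet_instance \<Rightarrow> nat" where
  "s_row I = (MAX i\<in>{..<num_values I}. card {j. j < num_sources I \<and> coeff I i j \<noteq> 0})"

definition s_col :: "'a prophet_instance \<Rightarrow> nat" where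
  "s_col I = (MAX j\<in>{..<num_sources I}. card {i. i < num_values I \<and> coeff I i j \<noteq> 0})"

definition expected_max :: "'a prophet_instance \<Rightarrow> real" where
  "expected_max I = (\<integral>\<omega>. (MAX i\<in>{..<num_values I}. X I i \<omega>) \<partial>sample I)"

text \<open>
  What an algorithm has seen when it decides about value \<open>i\<close>: the values \<open>X 0, \<dots>, X i\<close>, as an
  element of the product space over \<open>{..i}\<close>.
\<close>

abbreviation history_space :: "nat \<Rightarrow> (nat \<Rightarrow> real) measure" where
  "history_space i \<equiv> Pi\<^sub>M {..i} (\<lambda>_. borel)"

definition history :: "'a prophet_instance \<Rightarrow> nat \<Rightarrow> 'a \<Rightarrow> nat \<Rightarrow> real" where
  "history I i \<omega> = (\<lambda>k\<in>{..i}. X I k \<omega>)"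

text \<open>
  The internal randomness of an algorithm is a seed drawn from an arbitrary probability space \<open>R\<close>;
  taking the product with the sample space of the instance makes it independent of the sources.
  Algorithms may also be randomised afresh in every step, as \<open>R\<close> can itself be a product, and
  the earlier decisions need not be arguments since they are functions of the history and the seed.
  The seed type \<open>'r\<close> is arbitrary, but \<open>real\<close> is already as general as possible: a jointly
  measurable policy uses only a countably generated part of \<open>R\<close>, hence factors through a
  real-valued seed.
\<close>

type_synonym 'r fractional_policy = "nat \<Rightarrow> (nat \<Rightarrow> real) \<Rightarrow> 'r \<Rightarrow> real"
type_synonym 'r stopping_policy = "nat \<Rightarrow> (nat \<Rightarrow> real) \<Rightarrow> 'r \<Rightarrow> bool"

definition fractional_algorithm ::
  "'a prophet_instance \<Rightarrow> 'r measure \<Rightarrow> 'r fractional_policy \<Rightarrow> bool" where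
  "fractional_algorithm I R p \<longleftrightarrow>
     prob_space R \<and>
     (\<forall>i<num_values I. (\<lambda>(h, r). p i h r) \<in> borel_measurable (history_space i \<Otimes>\<^sub>M R)) \<and>
     (\<forall>i<num_values I. \<forall>h\<in>space (history_space i). \<forall>r\<in>space R. p i h r \<ge> 0) \<and>
     (AE (\<omega>, r) in sample I \<Otimes>\<^sub>M R. (\<Sum>i<num_values I. p i (history I i \<omega>) r) \<le> 1)"

definition fractional_reward ::
  "'a prophet_instance \<Rightarrow> 'r measure \<Rightarrow> 'r fractional_policy \<Rightarrow> real" where
  "fractional_reward I R p =
     (\<integral>(\<omega>, r). (\<Sum>i<num_values I. p i (history I i \<omega>) r * X I i \<omega>) \<partial>(sample I \<Otimes>\<^sub>M R))"

text \<open>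
  In the standard problem, \<open>q i h r\<close> says that the algorithm stops at value \<open>i\<close> if it has not
  stopped before; the reward is 0 if it rejects all values.
\<close>

definition stopping_algorithm ::
  "'a prophet_instance \<Rightarrow> 'r measure \<Rightarrow> 'r stopping_policy \<Rightarrow> bool" where
  "stopping_algorithm I R q \<longleftrightarrow>
     prob_space R \<and>
     (\<forall>i<num_values I. Measurable.pred (history_space i \<Otimes>\<^sub>M R) (\<lambda>(h, r). q i h r))"

definition stopping_reward ::
  "'a prophet_instance \<Rightarrow> 'r measure \<Rightarrow> 'r stopping_policy \<Rightarrow> real" where
  "stopping_reward I R q =
     (\<integral>(\<omega>, r). (if \<exists>i<num_values I. q i (history I i \<omega>) r
                then X I (LEAST i. i < num_values I \<and> q i (history I i \<omega>) r) \<omega>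
                else 0) \<partial>(sample I \<Otimes>\<^sub>M R))"

text \<open>
  An algorithm as a whole chooses its seed space and policy from what is known in advance: the
  dimensions, the matrix and the distributions of the sources.
\<close>

type_synonym prior_knowledge = "nat \<times> nat \<times> (nat \<Rightarrow> nat \<Rightarrow> real) \<times> (nat \<Rightarrow> real measure)"

definition known :: "'a prophet_instance \<Rightarrow> prior_knowledge" where
  "known I = (num_values I, num_sources I, coeff I,
     \<lambda>j\<in>{..<num_sources I}. distr (sample I) borel (source I j))"

definition fractional_guarantee ::
  "(prior_knowledge \<Rightarrow> 'r measure \<times> 'r fractional_policy) \<Rightarrow>
   'a prophet_instance set \<Rightarrow> real \<Rightarrow> bool" where
  "fractional_guarantee alg \<I> \<alpha> \<longleftrightarrow>
     (\<forall>I\<in>\<I>. case alg (known I) of (R, p) \<Rightarrow>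
        fractional_algorithm I R p \<and> fractional_reward I R p \<ge> 1 / \<alpha> * expected_max I)"

definition stopping_guarantee ::
  "(prior_knowledge \<Rightarrow> 'r measure \<times> 'r stopping_policy) \<Rightarrow>
   'a prophet_instance set \<Rightarrow> real \<Rightarrow> bool" where
  "stopping_guarantee alg \<I> \<alpha> \<longleftrightarrow>
     (\<forall>I\<in>\<I>. case alg (known I) of (R, q) \<Rightarrow>
        stopping_algorithm I R q \<and> stopping_reward I R q \<ge> 1 / \<alpha> * expected_max I)"

end

theory Submission
  imports Defs
begin

text \<open>
  Take independent sources \<open>Y j \<sim> Bernoulli (q / K ^ j)\<close> and let \<open>X i\<close> be \<open>K ^ i\<close> times the number
  of active sources \<open>j \<ge> i\<close>. For small \<open>q\<close> at most one source is active, up to an event of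
  probability \<open>O(q\<^sup>2)\<close>. If it is \<open>Y j\<close>, the values are \<open>1, K, \<dots>, K ^ j, 0, \<dots>, 0\<close>, so the maximum is
  \<open>K ^ j\<close> and its expectation is about \<open>c * q\<close>. While the values stay positive the algorithm sees
  the deterministic sequence \<open>1, K, K\<^sup>2, \<dots>\<close>; hence the fractions it commits to are fixed in advance
  and sum to at most 1, while each \<open>X i\<close> has expectation at most \<open>q * K / (K - 1)\<close>.
\<close>

subsection \<open>Stopping rules as fractional algorithms\<close>

text \<open>This puts fraction 1 on the first index at which \<open>s\<close> fires. A policy sees
  only the current history and the seed, so earlier decisions are recomputed from the restrictions
  of \<open>h\<close> with the same seed.\<close>

definition stop_fraction :: "'r stopping_policy \<Rightarrow> 'r fractional_policy" where
  "stop_fraction s i h r = of_bool (s i h r \<and> (\<forall>k<i. \<not> s k (restrict h {..k}) r))"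

lemma restrict_history: "k \<le> i \<Longrightarrow> restrict (history I i \<omega>) {..k} = history I k \<omega>"
  by (auto simp: history_def restrict_def)

lemma stop_fraction_history:
  "stop_fraction s i (history I i \<omega>) r =
     of_bool (s i (history I i \<omega>) r \<and> (\<forall>k<i. \<not> s k (history I k \<omega>) r))"
  by (simp add: stop_fraction_def restrict_history)

text \<open>At most one summand survives, the one at the first firing index. The weight
  \<open>f\<close> is left free for two uses: weight 1 yields the budget constraint, and the values
  as weights identify the two rewards.\<close>

lemma sum_stop_fraction:
  fixes I :: "'a prophet_instance" and s :: "'r stopping_policy" and f :: "nat \<Rightarrow> real"
  defines "P \<equiv> \<lambda>\<omega> r i. i < num_values I \<and> s i (history I i \<omega>) r"
  shows "(\<Sum>i<num_values I. stop_fraction s i (history I i \<omega>) r * f i) =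
           (if \<exists>i. P \<omega> r i then f (LEAST i. P \<omega> r i) else 0)"
proof (cases "\<exists>i. P \<omega> r i")
  case True
  define l where "l = (LEAST i. P \<omega> r i)"
  have l: "P \<omega> r l" and min: "\<And>k. k < l \<Longrightarrow> \<not> P \<omega> r k"
    unfolding l_def using True by (auto intro: LeastI_ex dest: not_less_Least)
  have "stop_fraction s i (history I i \<omega>) r = of_bool (i = l)" if "i < num_values I" for i
    using l min that unfolding stop_fraction_history P_def
    by (cases i l rule: linorder_cases) auto
  then have "(\<Sum>i<num_values I. stop_fraction s i (history I i \<omega>) r * f i) =
      (\<Sum>i<num_values I. if i = l then f i else 0)"
    by (intro sum.cong) auto
  also have "\<dots> = f l"
    using l by (simp add: P_def)
  finally show ?thesis
    using True by (simp add: l_def)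
next
  case False
  then show ?thesis
    by (auto simp: stop_fraction_history P_def intro!: sum.neutral)
qed

lemma fractional_algorithm_stop_fraction:
  assumes "stopping_algorithm I R s"
  shows "fractional_algorithm I R (stop_fraction s)"
proof -
  have meas: "(\<lambda>(h, r). stop_fraction s i h r) \<in> borel_measurable (history_space i \<Otimes>\<^sub>M R)"
    if i: "i < num_values I" for i
  proof -
    have pred: "Measurable.pred (history_space k \<Otimes>\<^sub>M R) (\<lambda>(h, r). s k h r)" if "k \<le> i" for k
      using assms i that by (auto simp: stopping_algorithm_def)
    have "Measurable.pred (history_space i \<Otimes>\<^sub>M R) (\<lambda>x. s k (restrict (fst x) {..k}) (snd x))"
      if "k < i" for k
    proof -
      have "(\<lambda>x. (restrict (fst x) {..k}, snd x)) \<in>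
          measurable (history_space i \<Otimes>\<^sub>M R) (history_space k \<Otimes>\<^sub>M R)"
        using that
        by (intro measurable_Pair measurable_snd
            measurable_compose[OF measurable_fst measurable_restrict_subset]) auto
      from measurable_compose[OF this pred[of k]] show ?thesis
        using that by (simp add: case_prod_beta)
    qed
    moreover have "Measurable.pred (history_space i \<Otimes>\<^sub>M R) (\<lambda>x. s i (fst x) (snd x))"
      using pred[of i] by (simp add: case_prod_beta)
    ultimately have "Measurable.pred (history_space i \<Otimes>\<^sub>M R)
        (\<lambda>x. s i (fst x) (snd x) \<and> (\<forall>k\<in>{..<i}. \<not> s k (restrict (fst x) {..k}) (snd x)))"
      by (intro pred_intros_logic pred_intros_finite) auto
    then show ?thesis
      by (simp add: stop_fraction_def case_prod_beta Ball_def)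
  qed
  have "(\<Sum>i<num_values I. stop_fraction s i (history I i \<omega>) r) \<le> 1" for \<omega> r
    using sum_stop_fraction[of s I \<omega> r "\<lambda>_. 1"] by (simp split: if_splits)
  then show ?thesis
    using assms meas
    by (auto simp: fractional_algorithm_def stopping_algorithm_def stop_fraction_def case_prod_beta)
qed

lemma fractional_reward_stop_fraction:
  "fractional_reward I R (stop_fraction s) = stopping_reward I R s"
  by (simp add: fractional_reward_def stopping_reward_def sum_stop_fraction)

text \<open>The integrand is nonnegative on the whole product space, and the default value 0 of a
  divergent Bochner integral respects the bound as well.\<close>

lemma fractional_reward_nonneg:
  assumes "linear_prophet I" "fractional_algorithm I R p"
  shows "fractional_reward I R p \<ge> 0"
proof -
  have "X I i \<omega> \<ge> 0" if "i < num_values I" "\<omega> \<in> space (sample I)" for i \<omega>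
    using assms(1) that by (auto simp: X_def linear_prophet_def intro!: sum_nonneg)
  moreover have "history I i \<omega> \<in> space (history_space i)" for i \<omega>
    by (simp add: history_def space_PiM)
  ultimately show ?thesis
    using assms(2) unfolding fractional_reward_def fractional_algorithm_def
    by (intro Bochner_Integration.integral_nonneg)
      (auto simp: space_pair_measure intro!: sum_nonneg mult_nonneg_nonneg)
qed

subsection \<open>The hard instance\<close>

definition coins :: "nat \<Rightarrow> real \<Rightarrow> real \<Rightarrow> (nat \<Rightarrow> real) pmf" where
  "coins c K q = Pi_pmf {..<c} 0 (\<lambda>j. map_pmf of_bool (bernoulli_pmf (q / K ^ j)))"

text \<open>An indicator instead of the coordinate \<open>\<omega> j\<close> itself:
  \<open>linear_prophet\<close> asks for nonnegative sources at every sample point, and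
  \<open>measure_pmf\<close> has points outside the support of \<open>coins\<close>.\<close>

definition active :: "nat \<Rightarrow> (nat \<Rightarrow> real) \<Rightarrow> real" where
  "active j \<omega> = of_bool (\<omega> j = 1)"

definition tower :: "nat \<Rightarrow> real \<Rightarrow> real \<Rightarrow> (nat \<Rightarrow> real) prophet_instance" where
  "tower c K q = \<lparr>num_values = c, num_sources = c, coeff = \<lambda>i j. if i \<le> j then K ^ i else 0,
     sample = measure_pmf (coins c K q), source = active\<rparr>"

text \<open>The number of ordered pairs of distinct active sources. It is an integer, so a value
  below 1 means that at most one source is active. It dominates the indicator of a collision, and
  its expectation follows by linearity, so it serves as a pointwise error term.\<close>

definition collisions :: "nat \<Rightarrow> (nat \<Rightarrow> real) \<Rightarrow> real" where
  "collisions c \<omega> = (\<Sum>j<c. \<Sum>k\<in>{..<c} - {j}. active j \<omega> * active k \<omega>)"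

lemma tower_simps [simp]:
  "num_values (tower c K q) = c" "num_sources (tower c K q) = c"
  "coeff (tower c K q) i j = (if i \<le> j then K ^ i else 0)"
  "sample (tower c K q) = measure_pmf (coins c K q)" "source (tower c K q) = active"
  by (simp_all add: tower_def)

lemma active_bounds [simp]: "0 \<le> active j \<omega>" "active j \<omega> \<le> 1"
  by (auto simp: active_def)

lemma collisions_nonneg: "0 \<le> collisions c \<omega>"
  by (auto simp: collisions_def intro!: sum_nonneg)

lemma collisions_ge_1:
  assumes "j < c" "k < c" "j \<noteq> k" "active j \<omega> = 1" "active k \<omega> = 1"
  shows "1 \<le> collisions c \<omega>"
proof -
  have "1 = active j \<omega> * active k \<omega>"
    using assms by simp
  also have "\<dots> \<le> (\<Sum>k\<in>{..<c} - {j}. active j \<omega> * active k \<omega>)"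
    using assms by (intro member_le_sum) auto
  also have "\<dots> \<le> collisions c \<omega>"
    unfolding collisions_def using assms
    by (intro member_le_sum[of j _ "\<lambda>j. \<Sum>k\<in>{..<c} - {j}. active j \<omega> * active k \<omega>"])
       (auto intro!: sum_nonneg)
  finally show ?thesis .
qed

lemma collisions_lt_1:
  assumes "collisions c \<omega> < 1" "j < c" "active j \<omega> = 1" "k < c" "k \<noteq> j"
  shows "active k \<omega> = 0"
  using collisions_ge_1[of j c k \<omega>] assms by (auto simp: active_def)

lemma X_tower: "X (tower c K q) i \<omega> = K ^ i * (\<Sum>j\<in>{i..<c}. active j \<omega>)"
proof -
  have "X (tower c K q) i \<omega> = (\<Sum>j<c. if i \<le> j then K ^ i * active j \<omega> else 0)"
    by (auto simp: X_def intro!: sum.cong)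
  also have "\<dots> = (\<Sum>j\<in>{i..<c}. K ^ i * active j \<omega>)"
    by (intro sum.mono_neutral_cong_right) auto
  finally show ?thesis
    by (simp add: sum_distrib_left)
qed

lemma X_tower_single:
  assumes "collisions c \<omega> < 1" "j < c" "active j \<omega> = 1"
  shows "X (tower c K q) i \<omega> = (if i \<le> j then K ^ i else 0)"
proof -
  have "(\<Sum>k\<in>{i..<c}. active k \<omega>) = (\<Sum>k\<in>{i..<c}. if k = j then 1 else 0)"
    using collisions_lt_1[OF assms] assms(3) by (intro sum.cong) auto
  also have "\<dots> = (if i \<le> j then 1 else 0)"
    using assms(2) by simp
  finally show ?thesis
    by (simp add: X_tower)
qed

definition tower_history :: "real \<Rightarrow> nat \<Rightarrow> nat \<Rightarrow> real" where
  "tower_history K i = (\<lambda>k\<in>{..i}. K ^ k)"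

text \<open>A nonzero value at \<open>i\<close> forces the single active source \<open>j\<close> to
  satisfy \<open>i \<le> j\<close>, and then the values up to \<open>i\<close> are powers of
  \<open>K\<close> whatever \<open>j\<close> is. The history thus reveals nothing about how much
  further the sequence climbs.\<close>

lemma history_tower:
  assumes "collisions c \<omega> < 1" "X (tower c K q) i \<omega> \<noteq> 0"
  shows "history (tower c K q) i \<omega> = tower_history K i"
proof -
  from assms(2) obtain j where j: "i \<le> j" "j < c" "active j \<omega> \<noteq> 0"
    by (auto simp: X_tower elim!: sum.not_neutral_contains_not_neutral)
  then have "active j \<omega> = 1"
    by (auto simp: active_def)
  with assms(1) j show ?thesis
    by (auto simp: history_def tower_history_def X_tower_single)
qed

section \<open>Support, moments and sparsity of the instance\<close>

locale tower_parameters =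
  fixes c :: nat and K q :: real
  assumes c: "c > 0" and K: "K > 1" and q: "0 < q" "q < 1"
begin

abbreviation "I \<equiv> tower c K q"
abbreviation "\<P> \<equiv> measure_pmf (coins c K q)"

lemma prob_bounds: "0 < q / K ^ j" "q / K ^ j < 1"
proof -
  show "0 < q / K ^ j"
    using K q by simp
  have "q < K ^ j"
    using q one_le_power[of K j] K by linarith
  then show "q / K ^ j < 1"
    using K by simp
qed

text \<open>All probabilities lie strictly between 0 and 1, so every 0/1 pattern has positive mass.
  The support is finite, which makes every real function integrable, and it contains the pattern in
  which only the last source is active.\<close>

lemma set_coins: "set_pmf (coins c K q) = PiE_dflt {..<c} 0 (\<lambda>_. {0, 1})"
proof -
  have "set_pmf (map_pmf of_bool (bernoulli_pmf (q / K ^ j))) = {0, 1 :: real}" for j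
    using prob_bounds[of j] by (auto simp: set_pmf_bernoulli UNIV_bool)
  then show ?thesis
    by (simp add: coins_def set_Pi_pmf comp_def)
qed

lemma integrable_coins [simp]:
  fixes f :: "(nat \<Rightarrow> real) \<Rightarrow> real"
  shows "integrable \<P> f"
  by (rule integrable_measure_pmf_finite) (simp add: set_coins finite_PiE_dflt)

lemma expectation_active:
  assumes "j < c"
  shows "measure_pmf.expectation (coins c K q) (active j) = q / K ^ j"
proof -
  have "measure_pmf.expectation (coins c K q) (active j) =
      measure_pmf.expectation (map_pmf (\<lambda>\<omega>. \<omega> j) (coins c K q)) (\<lambda>x. of_bool (x = 1))"
    by (simp add: active_def[abs_def])
  also have "\<dots> = q / K ^ j"
    using assms prob_bounds[of j] by (simp add: coins_def Pi_pmf_component)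
  finally show ?thesis .
qed

lemma indep_active: "prob_space.indep_vars \<P> (\<lambda>_. borel) active {..<c}"
  unfolding coins_def active_def[abs_def]
  by (rule prob_space.indep_vars_compose2[OF measure_pmf.prob_space_axioms indep_vars_Pi_pmf]) auto

lemma expectation_active_mult:
  assumes "j < c" "k < c" "j \<noteq> k"
  shows "measure_pmf.expectation (coins c K q) (\<lambda>\<omega>. active j \<omega> * active k \<omega>) \<le> q\<^sup>2"
proof -
  have "prob_space.indep_vars \<P> (\<lambda>_. borel) active {j, k}"
    using prob_space.indep_vars_subset[OF measure_pmf.prob_space_axioms indep_active, of "{j, k}"]
      assms by auto
  from prob_space.indep_vars_lebesgue_integral[OF measure_pmf.prob_space_axioms _ this]
  have "measure_pmf.expectation (coins c K q) (\<lambda>\<omega>. active j \<omega> * active k \<omega>) = q / K ^ j * (q / K ^ k)"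
    using assms by (simp add: expectation_active)
  also have "\<dots> \<le> q * q"
  proof -
    have "q / K ^ i \<le> q" for i
      using K q one_le_power[of K i] by (simp add: divide_le_eq)
    then show ?thesis
      using q prob_bounds(1) by (intro mult_mono) (auto intro: less_imp_le)
  qed
  finally show ?thesis
    by (simp add: power2_eq_square)
qed

lemma expectation_collisions:
  "measure_pmf.expectation (coins c K q) (collisions c) \<le> (real c)\<^sup>2 * q\<^sup>2"
proof -
  have "measure_pmf.expectation (coins c K q) (collisions c) =
     (\<Sum>j<c. \<Sum>k\<in>{..<c} - {j}. measure_pmf.expectation (coins c K q) (\<lambda>\<omega>. active j \<omega> * active k \<omega>))"
    by (simp add: collisions_def[abs_def])
  also have "\<dots> \<le> (\<Sum>j<c. \<Sum>k\<in>{..<c} - {j}. q\<^sup>2)"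
    by (intro sum_mono expectation_active_mult) auto
  also have "\<dots> = real c * real (c - 1) * q\<^sup>2"
    using c by simp
  also have "\<dots> \<le> (real c)\<^sup>2 * q\<^sup>2"
    by (intro mult_right_mono) (auto simp: power2_eq_square intro!: mult_left_mono)
  finally show ?thesis .
qed

lemma linear_prophet_tower: "linear_prophet I"
  using c K indep_active by (auto simp: linear_prophet_def measure_pmf.prob_space_axioms)

text \<open>The matrix is upper triangular: row \<open>i\<close> has \<open>c - i\<close> nonzero
  entries and column \<open>j\<close> has \<open>j + 1\<close>. The maxima are attained at row 0 and
  column \<open>c - 1\<close>.\<close>

lemma sparsity_tower: "s_row I = c" "s_col I = c"
proof -
  have row: "{j. j < c \<and> coeff I i j \<noteq> 0} = {i..<c}"
    and col: "{j. j < c \<and> coeff I j i \<noteq> 0} = {..<c} \<inter> {..i}" for i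
    using K by auto
  have "Max ((\<lambda>i. c - i) ` {..<c}) = c"
    using c by (intro Max_eqI) force+
  then show "s_row I = c"
    unfolding s_row_def tower_simps(1,2) row by simp
  have "card ({..<c} \<inter> {..i}) \<le> c" for i
    using card_mono[of "{..<c}" "{..<c} \<inter> {..i}"] by simp
  moreover have "{..<c} \<inter> {..c - 1} = {..<c}"
    using c by auto
  ultimately have "Max ((\<lambda>j. card ({..<c} \<inter> {..j})) ` {..<c}) = c"
    using c by (intro Max_eqI) (auto intro!: rev_image_eqI[of "c - 1"])
  then show "s_col I = c"
    unfolding s_col_def tower_simps(1,2) col by simp
qed

section \<open>Pointwise bounds and the expected maximum\<close>

lemma X_nonneg: "0 \<le> X I i \<omega>"
  using K by (auto simp: X_tower intro!: mult_nonneg_nonneg sum_nonneg)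

text \<open>A crude bound suffices: it prices the rare collisions, and it makes the reward bounded,
  hence integrable.\<close>

lemma X_le:
  assumes "i < c"
  shows "X I i \<omega> \<le> real c * K ^ c"
proof -
  have "(\<Sum>j\<in>{i..<c}. active j \<omega>) \<le> (\<Sum>j\<in>{i..<c}. 1)"
    by (intro sum_mono) auto
  also have "\<dots> \<le> real c"
    by simp
  finally have "(\<Sum>j\<in>{i..<c}. active j \<omega>) \<le> real c" .
  moreover have "K ^ i \<le> K ^ c"
    using assms K by (intro power_increasing) auto
  ultimately have "K ^ i * (\<Sum>j\<in>{i..<c}. active j \<omega>) \<le> K ^ c * real c"
    using K by (intro mult_mono sum_nonneg) auto
  then show ?thesis
    by (simp add: X_tower mult.commute)
qed

text \<open>With one active source \<open>j\<close>, the sum is \<open>K ^ j\<close>, which is the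
  value \<open>X I j \<omega>\<close>. With none it is 0. With a collision the subtracted term is at
  least \<open>c * K ^ c\<close>, which already exceeds or equals the sum.\<close>

lemma max_ge:
  "(MAX i\<in>{..<c}. X I i \<omega>) \<ge> (\<Sum>j<c. K ^ j * active j \<omega>) - real c * K ^ c * collisions c \<omega>"
proof -
  let ?M = "MAX i\<in>{..<c}. X I i \<omega>"
  have M: "X I i \<omega> \<le> ?M" if "i < c" for i
    using that by auto
  have M0: "0 \<le> ?M"
    using M[of 0] X_nonneg[of 0 \<omega>] c by linarith
  consider "collisions c \<omega> \<ge> 1" | "\<forall>j<c. active j \<omega> = 0"
    | j where "collisions c \<omega> < 1" "j < c" "active j \<omega> = 1"
    by (cases "collisions c \<omega> < 1") (auto simp: active_def)
  then show ?thesis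
  proof cases
    case 1
    have "(\<Sum>j<c. K ^ j * active j \<omega>) \<le> (\<Sum>j<c. K ^ c * 1)"
      using K by (intro sum_mono mult_mono power_increasing) auto
    also have "\<dots> \<le> real c * K ^ c * collisions c \<omega>"
      using 1 K mult_left_mono[of 1 "collisions c \<omega>" "real c * K ^ c"] by simp
    finally show ?thesis
      using M0 by linarith
  next
    case 2
    then have "(\<Sum>j<c. K ^ j * active j \<omega>) = 0"
      by simp
    moreover have "real c * K ^ c * collisions c \<omega> \<ge> 0"
      using K collisions_nonneg[of c \<omega>] by auto
    ultimately show ?thesis
      using M0 by linarith
  next
    case 3
    have "(\<Sum>k<c. K ^ k * active k \<omega>) = (\<Sum>k<c. if k = j then K ^ j else 0)"
      using collisions_lt_1[OF 3] 3(3) by (intro sum.cong) auto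
    also have "\<dots> = X I j \<omega>"
      using 3 by (simp add: X_tower_single)
    also have "\<dots> \<le> ?M"
      using M 3 by simp
    finally have "(\<Sum>k<c. K ^ k * active k \<omega>) \<le> ?M" .
    moreover have "real c * K ^ c * collisions c \<omega> \<ge> 0"
      using K collisions_nonneg[of c \<omega>] by auto
    ultimately show ?thesis
      by linarith
  qed
qed

text \<open>The factors \<open>K ^ j\<close> and \<open>q / K ^ j\<close> cancel, so each source
  contributes exactly \<open>q\<close>; collisions cost only order \<open>q\<^sup>2\<close>.\<close>

lemma expected_max_ge: "expected_max I \<ge> real c * q - real c ^ 3 * K ^ c * q\<^sup>2"
proof -
  have "real c * q - real c ^ 3 * K ^ c * q\<^sup>2 = real c * q - real c * K ^ c * ((real c)\<^sup>2 * q\<^sup>2)"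
    by (simp add: power3_eq_cube power2_eq_square)
  also have "\<dots> \<le> real c * q -
      real c * K ^ c * measure_pmf.expectation (coins c K q) (collisions c)"
    using expectation_collisions K by (intro diff_left_mono mult_left_mono) auto
  also have "\<dots> = (\<integral>\<omega>. (\<Sum>j<c. K ^ j * active j \<omega>) - real c * K ^ c * collisions c \<omega> \<partial>\<P>)"
    using K by (simp add: expectation_active)
  also have "\<dots> \<le> expected_max I"
    unfolding expected_max_def tower_simps by (intro integral_mono max_ge) auto
  finally show ?thesis .
qed

section \<open>Upper bound on the reward of fractional algorithms\<close>

lemma sum_prob_le: "K ^ i * (\<Sum>j\<in>{i..<c}. q / K ^ j) \<le> q * (K / (K - 1))"
proof -
  \<comment> \<open>The left side is the expectation of \<open>X I i\<close>. After the shift by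
    \<open>i\<close> it is a partial geometric sum, bounded by the full series uniformly in
    \<open>i\<close> and \<open>c\<close>.\<close>
  have "K ^ i * (\<Sum>j\<in>{i..<c}. q / K ^ j) = (\<Sum>j\<in>{i..<c}. q * (1 / K) ^ (j - i))"
    unfolding sum_distrib_left
  proof (rule sum.cong[OF refl])
    fix j assume "j \<in> {i..<c}"
    then have "K ^ j = K ^ i * K ^ (j - i)"
      by (simp flip: power_add)
    then show "K ^ i * (q / K ^ j) = q * (1 / K) ^ (j - i)"
      using K by (simp add: power_divide)
  qed
  also have "\<dots> = (\<Sum>j<c - i. q * (1 / K) ^ j)"
    by (rule sum.reindex_bij_witness[of _ "\<lambda>j. j + i" "\<lambda>j. j - i"]) auto
  also have "\<dots> = q * (\<Sum>j<c - i. (1 / K) ^ j)"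
    by (simp add: sum_distrib_left)
  also have "\<dots> \<le> q * (\<Sum>j. (1 / K) ^ j)"
    using K q by (intro mult_left_mono sum_le_suminf summable_geometric) auto
  also have "(\<Sum>j. (1 / K) ^ j) = K / (K - 1)"
    using K by (subst suminf_geometric) (auto simp: field_simps)
  finally show ?thesis .
qed

text \<open>\<open>a i\<close> is the fraction chosen at time \<open>i\<close> when all values so far were positive.\<close>
lemma reward_le:
  assumes f: "\<And>i. i < c \<Longrightarrow> 0 \<le> f i" "(\<Sum>i<c. f i) \<le> 1" and a: "\<And>i. i < c \<Longrightarrow> 0 \<le> a i"
    and fa: "\<And>i. i < c \<Longrightarrow> history I i \<omega> = tower_history K i \<Longrightarrow> f i = a i"
  shows "(\<Sum>i<c. f i * X I i \<omega>) \<le> (\<Sum>i<c. a i * X I i \<omega>) + real c * K ^ c * collisions c \<omega>"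
proof (cases "collisions c \<omega> < 1")
  case True
  \<comment> \<open>Fractions spent on zero values earn nothing, and at a nonzero value the history
    is the deterministic one, where \<open>f\<close> and \<open>a\<close> agree.\<close>
  have "(\<Sum>i<c. f i * X I i \<omega>) = (\<Sum>i<c. a i * X I i \<omega>)"
  proof (rule sum.cong[OF refl])
    fix i assume "i \<in> {..<c}"
    then show "f i * X I i \<omega> = a i * X I i \<omega>"
      using fa history_tower[OF True, of K q i] by (cases "X I i \<omega> = 0") auto
  qed
  then show ?thesis
    using K collisions_nonneg[of c \<omega>] by auto
next
  case False
  \<comment> \<open>Under a collision, the budget limits the reward to the largest possible value,
    which the error term covers.\<close>
  have "(\<Sum>i<c. f i * X I i \<omega>) \<le> (\<Sum>i<c. f i * (real c * K ^ c))"
    using f X_le by (intro sum_mono mult_left_mono) auto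
  also have "\<dots> = (\<Sum>i<c. f i) * (real c * K ^ c)"
    by (simp add: sum_distrib_right)
  also have "\<dots> \<le> 1 * (real c * K ^ c)"
    using K f by (intro mult_right_mono) auto
  also have "\<dots> \<le> real c * K ^ c * collisions c \<omega>"
    using False K mult_left_mono[of 1 "collisions c \<omega>" "real c * K ^ c"] by simp
  finally show ?thesis
    using a X_nonneg by (intro add_increasing) (auto intro!: sum_nonneg)
qed

lemma expectation_fixed_fractions:
  assumes a: "\<And>i. i < c \<Longrightarrow> 0 \<le> a i" "(\<Sum>i<c. a i) \<le> 1"
  shows "(\<integral>\<omega>. (\<Sum>i<c. a i * X I i \<omega>) \<partial>\<P>) \<le> q * (K / (K - 1))"
proof -
  have "(\<integral>\<omega>. (\<Sum>i<c. a i * X I i \<omega>) \<partial>\<P>) = (\<Sum>i<c. a i * (K ^ i * (\<Sum>j\<in>{i..<c}. q / K ^ j)))"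
    by (simp add: X_tower expectation_active)
  also have "\<dots> \<le> (\<Sum>i<c. a i * (q * (K / (K - 1))))"
    using a sum_prob_le by (intro sum_mono mult_left_mono) auto
  also have "\<dots> = (\<Sum>i<c. a i) * (q * (K / (K - 1)))"
    by (rule sum_distrib_right[symmetric])
  also have "\<dots> \<le> 1 * (q * (K / (K - 1)))"
    using a K q by (intro mult_right_mono) auto
  finally show ?thesis
    by simp
qed

text \<open>Conditioning on the seed by Fubini reduces to deterministic policies. For a fixed seed,
  the fractions on the deterministic history are constants, and \<open>reward_le\<close> with
  \<open>expectation_fixed_fractions\<close> bounds the inner integral.\<close>

lemma fractional_reward_le:
  fixes R :: "'r measure"
  assumes alg: "fractional_algorithm I R p"
  shows "fractional_reward I R p \<le> q * (K / (K - 1)) + real c ^ 3 * K ^ c * q\<^sup>2"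
    (is "_ \<le> ?B")
proof -
  interpret R: prob_space R
    using alg by (simp add: fractional_algorithm_def)
  interpret PR: pair_prob_space "\<P>" R ..
  define f where "f \<omega> r i = p i (history I i \<omega>) r" for \<omega> r i
  define a where "a r i = p i (tower_history K i) r" for r i
  have f_nonneg: "0 \<le> f \<omega> r i" if "i < c" "r \<in> space R" for \<omega> r i
    using alg that by (simp add: fractional_algorithm_def f_def history_def space_PiM)
  have a_nonneg: "0 \<le> a r i" if "i < c" "r \<in> space R" for r i
    using alg that by (simp add: fractional_algorithm_def a_def tower_history_def space_PiM)
  have f_meas [measurable]: "(\<lambda>x. f (fst x) (snd x) i) \<in> borel_measurable (\<P> \<Otimes>\<^sub>M R)"
    if "i < c" for i
  proof -
    have "(\<lambda>\<omega>. history I i \<omega>) \<in> measurable \<P> (history_space i)"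
      by (auto simp: history_def space_PiM)
    then have "(\<lambda>x. (history I i (fst x), snd x)) \<in>
        measurable (\<P> \<Otimes>\<^sub>M R) (history_space i \<Otimes>\<^sub>M R)"
      by (intro measurable_Pair measurable_snd measurable_compose[OF measurable_fst])
    moreover have "(\<lambda>(h, r). p i h r) \<in> borel_measurable (history_space i \<Otimes>\<^sub>M R)"
      using alg that by (simp add: fractional_algorithm_def)
    ultimately show ?thesis
      using measurable_compose[of _ "\<P> \<Otimes>\<^sub>M R" "history_space i \<Otimes>\<^sub>M R"]
      by (fastforce simp: f_def)
  qed
  have X_meas [measurable]: "(\<lambda>x. X I i (fst x)) \<in> borel_measurable (\<P> \<Otimes>\<^sub>M R)" for i
    by (rule measurable_compose[OF measurable_fst]) simp
  let ?g = "\<lambda>\<omega> r. \<Sum>i<c. f \<omega> r i * X I i \<omega>"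
  have g_meas: "(\<lambda>x. ?g (fst x) (snd x)) \<in> borel_measurable (\<P> \<Otimes>\<^sub>M R)"
    by (intro borel_measurable_sum borel_measurable_times) auto
  have f_le: "AE x in \<P> \<Otimes>\<^sub>M R. (\<Sum>i<c. f (fst x) (snd x) i) \<le> 1"
    using alg unfolding fractional_algorithm_def tower_simps f_def case_prod_beta by blast
  \<comment> \<open>The budget holds only almost everywhere, so the reward is bounded only almost
    everywhere; this gives the integrability that Fubini requires.\<close>
  have "AE x in \<P> \<Otimes>\<^sub>M R. norm (?g (fst x) (snd x)) \<le> real c * K ^ c"
    using f_le
  proof (rule AE_mp, intro AE_I2 impI)
    fix x assume x: "x \<in> space (\<P> \<Otimes>\<^sub>M R)" and le: "(\<Sum>i<c. f (fst x) (snd x) i) \<le> 1"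
    have r: "snd x \<in> space R"
      using x by (auto simp: space_pair_measure)
    have "?g (fst x) (snd x) \<le> (\<Sum>i<c. f (fst x) (snd x) i * (real c * K ^ c))"
      using f_nonneg r X_le by (intro sum_mono mult_left_mono) auto
    also have "\<dots> = (\<Sum>i<c. f (fst x) (snd x) i) * (real c * K ^ c)"
      by (simp add: sum_distrib_right)
    also have "\<dots> \<le> 1 * (real c * K ^ c)"
      using K le by (intro mult_right_mono) auto
    finally have "?g (fst x) (snd x) \<le> real c * K ^ c"
      by simp
    moreover have "0 \<le> ?g (fst x) (snd x)"
      using f_nonneg r X_nonneg by (intro sum_nonneg mult_nonneg_nonneg) auto
    ultimately show "norm (?g (fst x) (snd x)) \<le> real c * K ^ c"
      by simp
  qed
  then have g_int: "integrable (\<P> \<Otimes>\<^sub>M R) (case_prod ?g)"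
    using PR.integrable_const_bound[OF _ g_meas] by (simp add: case_prod_beta')
  \<comment> \<open>With the seed outermost, the inner almost-everywhere statement over a discrete
    measure becomes validity at every point of the support.\<close>
  have "AE r in R. AE \<omega> in \<P>. (\<Sum>i<c. f \<omega> r i) \<le> 1"
  proof -
    have "{x \<in> space (\<P> \<Otimes>\<^sub>M R). (\<Sum>i<c. f (fst x) (snd x) i) \<le> 1} \<in> sets (\<P> \<Otimes>\<^sub>M R)"
      by (intro borel_measurable_le borel_measurable_sum) auto
    from PR.AE_commute[OF this] PR.AE_pair[OF f_le] show ?thesis
      by simp
  qed
  then have "AE r in R. (\<integral>\<omega>. ?g \<omega> r \<partial>\<P>) \<le> ?B"
  proof (rule AE_mp, intro AE_I2 impI)
    fix r assume r: "r \<in> space R" and "AE \<omega> in \<P>. (\<Sum>i<c. f \<omega> r i) \<le> 1"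
    then have le: "(\<Sum>i<c. f \<omega> r i) \<le> 1" if "\<omega> \<in> set_pmf (coins c K q)" for \<omega>
      using that by (simp add: AE_measure_pmf_iff)
    text \<open>\<open>\<omega>0\<close> has positive probability and keeps all values positive, so \<open>a r\<close> sums to at most 1.\<close>
    define \<omega>0 :: "nat \<Rightarrow> real" where "\<omega>0 j = of_bool (j = c - 1)" for j
    have "\<omega>0 \<in> set_pmf (coins c K q)"
      using c by (auto simp: set_coins PiE_dflt_def \<omega>0_def)
    moreover have "f \<omega>0 r i = a r i" if "i < c" for i
    proof -
      have "collisions c \<omega>0 = 0"
        by (auto simp: collisions_def active_def \<omega>0_def intro!: sum.neutral)
      moreover have "active (c - 1) \<omega>0 = 1"
        by (simp add: active_def \<omega>0_def)
      ultimately have "X I i \<omega>0 \<noteq> 0"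
        using that K by (simp add: X_tower_single[of c _ "c - 1"])
      with \<open>collisions c \<omega>0 = 0\<close> show ?thesis
        by (simp add: f_def a_def history_tower)
    qed
    ultimately have a_le: "(\<Sum>i<c. a r i) \<le> 1"
      using le[of \<omega>0] by simp
    have "(\<integral>\<omega>. ?g \<omega> r \<partial>\<P>) \<le>
        (\<integral>\<omega>. (\<Sum>i<c. a r i * X I i \<omega>) + real c * K ^ c * collisions c \<omega> \<partial>\<P>)"
    proof (rule integral_mono_AE)
      show "AE \<omega> in \<P>. ?g \<omega> r \<le> (\<Sum>i<c. a r i * X I i \<omega>) + real c * K ^ c * collisions c \<omega>"
        unfolding AE_measure_pmf_iff using f_nonneg a_nonneg r le
        by (intro ballI reward_le) (auto simp: f_def a_def)
    qed auto
    also have "\<dots> = (\<integral>\<omega>. (\<Sum>i<c. a r i * X I i \<omega>) \<partial>\<P>) +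
        real c * K ^ c * measure_pmf.expectation (coins c K q) (collisions c)"
      by simp
    also have "\<dots> \<le> q * (K / (K - 1)) + real c * K ^ c * ((real c)\<^sup>2 * q\<^sup>2)"
      using a_nonneg r a_le K expectation_collisions
      by (intro add_mono expectation_fixed_fractions mult_left_mono) auto
    also have "\<dots> = ?B"
      by (simp add: power3_eq_cube power2_eq_square)
    finally show "(\<integral>\<omega>. ?g \<omega> r \<partial>\<P>) \<le> ?B" .
  qed
  then have "(\<integral>r. (\<integral>\<omega>. ?g \<omega> r \<partial>\<P>) \<partial>R) \<le> ?B"
    using PR.integrable_snd[OF g_int] by (intro R.integral_le_const) auto
  then show ?thesis
    using PR.integral_snd[OF g_int] by (simp add: fractional_reward_def f_def)
qed

end

section \<open>Choice of parameters and comparison of the two bounds\<close>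

lemma hard_instance:
  fixes c :: nat and \<delta> :: real
  assumes "c > 0" "\<delta> > 0"
  shows "\<exists>I :: (nat \<Rightarrow> real) prophet_instance.
       linear_prophet I \<and>
       num_values I = c \<and> s_row I = c \<and> s_col I = c \<and>
       expected_max I > 0 \<and>
       (\<forall>(R :: 'r measure) p. fractional_algorithm I R p \<longrightarrow>
          expected_max I \<ge> (real c - \<delta>) * fractional_reward I R p) \<and>
       (\<forall>(R :: 'r measure) q. stopping_algorithm I R q \<longrightarrow>
          expected_max I \<ge> (real c - \<delta>) * stopping_reward I R q)"
proof -
  \<comment> \<open>The cap at \<open>c / 2\<close> keeps \<open>c - d\<close> positive, so that the
    upper bound on the reward may be multiplied by it.\<close>
  define d where "d = min \<delta> (real c / 2)"
  have d: "0 < d" "d \<le> \<delta>" "d \<le> real c / 2"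
    using assms by (auto simp: d_def)
  \<comment> \<open>\<open>K\<close> makes \<open>K / (K - 1)\<close> equal to
    \<open>1 + d / (2 * c)\<close>. \<open>\<eta>\<close> is chosen so that
    \<open>\<eta> * (1 + c) = d / 2\<close>, and \<open>q\<close> turns the collision error
    \<open>c ^ 3 * K ^ c * q\<^sup>2\<close> into \<open>q * \<eta>\<close>. Both bounds then scale
    with \<open>q\<close>.\<close>
  define K where "K = 1 + 2 * real c / d"
  define \<eta> where "\<eta> = d / (2 * (1 + real c))"
  define q where "q = \<eta> / (real c ^ 3 * K ^ c)"
  have K: "K > 1"
    using assms d by (simp add: K_def)
  have \<eta>: "0 < \<eta>" "\<eta> < 1" "\<eta> * (1 + real c) = d / 2"
    using assms d by (auto simp: \<eta>_def field_simps)
  have pos: "1 \<le> real c ^ 3 * K ^ c"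
    using assms K mult_mono[of 1 "real c ^ 3" 1 "K ^ c"] by (simp add: one_le_power)
  have q_pos: "0 < q"
    unfolding q_def using pos \<eta> by (intro divide_pos_pos) auto
  have q_eq: "real c ^ 3 * K ^ c * q = \<eta>"
    using assms K by (simp add: q_def)
  have q_less: "q < 1"
    using mult_right_mono[OF pos, of q] q_pos q_eq \<eta>(2) by linarith
  interpret tower_parameters c K q
    using assms K q_pos q_less by unfold_locales auto
  have penalty: "real c ^ 3 * K ^ c * q\<^sup>2 = q * \<eta>"
    unfolding q_eq[symmetric] by (simp add: power2_eq_square)
  have E: "expected_max (tower c K q) \<ge> q * (real c - \<eta>)"
    using expected_max_ge unfolding penalty by (simp add: algebra_simps)
  have E_pos: "expected_max (tower c K q) > 0"
  proof -
    have "real c - \<eta> > 0"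
      using \<eta> assms by linarith
    then show ?thesis
      using E q_pos mult_pos_pos[of q "real c - \<eta>"] by linarith
  qed
  have *: "expected_max (tower c K q) \<ge> (real c - \<delta>) * fractional_reward (tower c K q) R p"
    if alg: "fractional_algorithm (tower c K q) R p" for R :: "'r measure" and p
  proof -
    have KK: "K / (K - 1) = 1 + d / (2 * real c)"
      using assms d by (simp add: K_def field_simps)
    have "fractional_reward (tower c K q) R p \<le> q * (1 + d / (2 * real c) + \<eta>)"
      using fractional_reward_le[OF alg] unfolding KK penalty by (simp add: algebra_simps)
    then have "(real c - d) * fractional_reward (tower c K q) R p \<le>
        (real c - d) * (q * (1 + d / (2 * real c) + \<eta>))"
      using d assms by (intro mult_left_mono) auto
    also have "\<dots> = q * (real c - d + (real c - d) * (d / (2 * real c)) + (real c - d) * \<eta>)"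
      by (simp add: algebra_simps)
    \<comment> \<open>Enlarging \<open>c - d\<close> to \<open>c\<close> in the error terms leaves
      \<open>c - d / 2 + c * \<eta>\<close>, which is \<open>c - \<eta>\<close> by the choice of
      \<open>\<eta>\<close>.\<close>
    also have "\<dots> \<le> q * (real c - d + real c * (d / (2 * real c)) + real c * \<eta>)"
      using q_pos d \<eta> by (intro mult_left_mono add_mono mult_right_mono) auto
    also have "real c - d + real c * (d / (2 * real c)) + real c * \<eta> = real c - \<eta>"
      using \<eta>(3) assms by (simp add: algebra_simps)
    also note E
    finally have "(real c - d) * fractional_reward (tower c K q) R p \<le> expected_max (tower c K q)" .
    \<comment> \<open>\<open>c - \<delta>\<close> may be negative; nonnegativity of the reward is
      what permits replacing \<open>d\<close> by the larger \<open>\<delta>\<close>.\<close>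
    moreover have "(real c - \<delta>) * fractional_reward (tower c K q) R p \<le>
        (real c - d) * fractional_reward (tower c K q) R p"
      using d fractional_reward_nonneg[OF linear_prophet_tower alg] by (intro mult_right_mono) auto
    ultimately show ?thesis
      by linarith
  qed
  have "expected_max (tower c K q) \<ge> (real c - \<delta>) * stopping_reward (tower c K q) R s"
    if "stopping_algorithm (tower c K q) R s" for R :: "'r measure" and s
    using *[OF fractional_algorithm_stop_fraction[OF that]]
    by (simp add: fractional_reward_stop_fraction)
  with * E_pos linear_prophet_tower sparsity_tower show ?thesis
    by (intro exI[of _ "tower c K q"] conjI allI impI) simp_all
qed

theorem theorem4p12:
  fixes c :: nat
  assumes "c > 0"
  shows "(\<forall>\<delta>::real. \<delta> > 0 \<longrightarrow>
      (\<exists>I :: (nat \<Rightarrow> real) prophet_instance.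
         linear_prophet I \<and>
         num_values I = c \<and> s_row I = c \<and> s_col I = c \<and>
         expected_max I > 0 \<and>
         (\<forall>(R :: 'r measure) p. fractional_algorithm I R p \<longrightarrow>
            expected_max I \<ge> (real c - \<delta>) * fractional_reward I R p) \<and>
         (\<forall>(R :: 'r measure) q. stopping_algorithm I R q \<longrightarrow>
            expected_max I \<ge> (real c - \<delta>) * stopping_reward I R q))) \<and>
    (\<forall>\<alpha>::real. 0 < \<alpha> \<and> \<alpha> < real c \<longrightarrow>
      \<not> (\<exists>alg :: prior_knowledge \<Rightarrow> 'r measure \<times> 'r fractional_policy.
           fractional_guarantee alg
             {I :: (nat \<Rightarrow> real) prophet_instance.
                linear_prophet I \<and> min (s_col I) (s_row I) = c} \<alpha>) \<and>
      \<not> (\<exists>alg :: prior_knowledge \<Rightarrow> 'r measure \<times> 'r stopping_policy.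
           stopping_guarantee alg
             {I :: (nat \<Rightarrow> real) prophet_instance.
                linear_prophet I \<and> min (s_col I) (s_row I) = c} \<alpha>))"
proof (rule conjI; intro allI impI)
  fix \<delta> :: real
  assume "\<delta> > 0"
  with assms show "\<exists>I :: (nat \<Rightarrow> real) prophet_instance.
       linear_prophet I \<and>
       num_values I = c \<and> s_row I = c \<and> s_col I = c \<and>
       expected_max I > 0 \<and>
       (\<forall>(R :: 'r measure) p. fractional_algorithm I R p \<longrightarrow>
          expected_max I \<ge> (real c - \<delta>) * fractional_reward I R p) \<and>
       (\<forall>(R :: 'r measure) q. stopping_algorithm I R q \<longrightarrow>
          expected_max I \<ge> (real c - \<delta>) * stopping_reward I R q)"
    by (rule hard_instance)
next
  fix \<alpha> :: real
  assume \<alpha>: "0 < \<alpha> \<and> \<alpha> < real c"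
  \<comment> \<open>Half the gap, so that \<open>c - \<delta>\<close> is the midpoint of
    \<open>\<alpha>\<close> and \<open>c\<close>.\<close>
  define \<delta> where "\<delta> = (real c - \<alpha>) / 2"
  have "\<delta> > 0" and gap: "real c - \<delta> > \<alpha>"
    using \<alpha> by (auto simp: \<delta>_def field_simps)
  from hard_instance[where 'r = 'r, OF assms \<open>\<delta> > 0\<close>]
  obtain I :: "(nat \<Rightarrow> real) prophet_instance"
    where I: "linear_prophet I" "s_row I = c" "s_col I = c" "expected_max I > 0"
      and frac: "\<forall>(R :: 'r measure) p. fractional_algorithm I R p \<longrightarrow>
         expected_max I \<ge> (real c - \<delta>) * fractional_reward I R p"
      and stop: "\<forall>(R :: 'r measure) s. stopping_algorithm I R s \<longrightarrow>
         expected_max I \<ge> (real c - \<delta>) * stopping_reward I R s"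
    by (elim exE conjE)
  \<comment> \<open>A guarantee of ratio \<open>\<alpha>\<close> contradicts the hard instance.
    Positivity of the expected maximum makes the inequality strict; with value 0 both bounds could
    hold.\<close>
  have low: "\<not> expected_max I \<ge> (real c - \<delta>) * v" if "v \<ge> 1 / \<alpha> * expected_max I" for v
  proof -
    have ratio: "1 < (real c - \<delta>) / \<alpha>"
      using gap \<alpha> by simp
    have "expected_max I < (real c - \<delta>) / \<alpha> * expected_max I"
      using mult_strict_right_mono[OF ratio I(4)] by simp
    also have "\<dots> = (real c - \<delta>) * (1 / \<alpha> * expected_max I)"
      by simp
    also have "\<dots> \<le> (real c - \<delta>) * v"
      using that gap \<alpha> by (intro mult_left_mono) auto
    finally show ?thesis
      by simp
  qed
  let ?\<I> = "{I :: (nat \<Rightarrow> real) prophet_instance. linear_prophet I \<and> min (s_col I) (s_row I) = c}"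
  have I_in: "I \<in> ?\<I>"
    using I by simp
  have "\<not> fractional_guarantee alg ?\<I> \<alpha>"
    for alg :: "prior_knowledge \<Rightarrow> 'r measure \<times> 'r fractional_policy"
  proof
    assume "fractional_guarantee alg ?\<I> \<alpha>"
    with I_in have "case alg (known I) of (R, p) \<Rightarrow>
        fractional_algorithm I R p \<and> fractional_reward I R p \<ge> 1 / \<alpha> * expected_max I"
      unfolding fractional_guarantee_def by (rule bspec[rotated])
    with low frac show False
      by (cases "alg (known I)") auto
  qed
  moreover have "\<not> stopping_guarantee alg ?\<I> \<alpha>"
    for alg :: "prior_knowledge \<Rightarrow> 'r measure \<times> 'r stopping_policy"
  proof
    assume "stopping_guarantee alg ?\<I> \<alpha>"
    with I_in have "case alg (known I) of (R, s) \<Rightarrow>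
        stopping_algorithm I R s \<and> stopping_reward I R s \<ge> 1 / \<alpha> * expected_max I"
      unfolding stopping_guarantee_def by (rule bspec[rotated])
    with low stop show False
      by (cases "alg (known I)") auto
  qed
  ultimately show "\<not> (\<exists>alg :: prior_knowledge \<Rightarrow> 'r measure \<times> 'r fractional_policy.
        fractional_guarantee alg ?\<I> \<alpha>) \<and>
      \<not> (\<exists>alg :: prior_knowledge \<Rightarrow> 'r measure \<times> 'r stopping_policy.
        stopping_guarantee alg ?\<I> \<alpha>)"
    by (intro conjI notI) (elim exE, simp)+
qed

end
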